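(* Let $k\ge 2$ be an integer and let $\varepsilon_1,\dots,\varepsilon_{k-1}\in\{-1,1\}$. Then the set of positive integers $n$ for which \[ \varepsilon_1(\phi(n+1)-\phi(n+2)) > 0,\quad \varepsilon_2(\phi(n+2)-\phi(n+3)) > 0,\quad \dots,\quad \varepsilon_{k-1}(\phi(n+k-1)-\phi(n+k)) > 0 \] all hold has positive lower density.
   Context: $\phi$ denotes the Euler phi-function. The lower density of a set $S$ of positive integers is $\liminf_{x\to\infty} \frac1x\#\{n\in S: n\le x\}$. *)

theory Defs
  imports "HOL-Number_Theory.Totient" "HOL-Library.Extended_Real" "HOL-Library.Liminf_Limsup"
begin

text \<open>
  The variable \<open>x\<close> runs over the reals. The lower limit is taken in the extended reals, where it
  always exists. The definition is meant for sets of positive integers.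
\<close>
definition lower_density :: "nat set \<Rightarrow> ereal" where
  "lower_density S =
     Liminf at_top (\<lambda>x::real. ereal (real (card {n \<in> S. real n \<le> x}) / x))"

end

theory Submission
  imports Defs "HOL-Number_Theory.Number_Theory" "HOL-Analysis.Harmonic_Numbers"
    "HOL-Real_Asymp.Real_Asymp"
begin

text \<open>
  Since \<open>\<phi>(m) / m\<close> is the product of \<open>1 - 1/p\<close> over the primes \<open>p\<close> dividing \<open>m\<close>, the sign pattern can
  be forced by prescribing the small prime factors of \<open>n + 1, \<dots>, n + k\<close>. The product of \<open>1 - 1/p\<close>
  over finite sets of arbitrarily large primes can be made arbitrarily small, because the harmonic
  series diverges (\<open>ex_primes_prod_less\<close>). Hence one can pick disjoint finite sets \<open>A i\<close> of primes
  above \<open>k\<close> such that, if \<open>n + i\<close> is divisible by the primes in \<open>A i\<close> and otherwise only by the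
  primes \<open>p \<le> k\<close> that divide \<open>i\<close>, then neighbouring values of \<open>\<phi>(n + i) / (n + i)\<close> differ by a
  factor of more than 2, in the prescribed direction (\<open>ex_prime_sets_realising_rank\<close>). By the
  Chinese remainder theorem this is arranged, as far as primes up to a bound \<open>y\<close> are concerned, by
  a congruence condition on \<open>n\<close> modulo \<open>y!\<close> (\<open>ex_residue_class_small_part\<close>).

  Primes beyond \<open>y\<close> change \<open>\<phi>(n + i) / (n + i)\<close> by a factor of at least \<open>1 - s\<close>, where \<open>s\<close> is the sum
  of \<open>1/p\<close> over the primes \<open>p > y\<close> dividing \<open>n + i\<close>. Over the first \<open>T\<close> members of the residue class
  these sums add up to at most \<open>T \<Sum> 1/p\<^sup>2 + O(log T) \<le> T/y + O(log T)\<close>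
  (\<open>sum_large_sum_le\<close>), so for \<open>y \<ge> 8k\<close> a positive proportion of the class has \<open>s \<le> 1/4\<close> for all \<open>i\<close>
  (\<open>eventually_card_all_large_sum_le\<close>). A loss of a quarter does not spoil a gap of a factor 2.
\<close>

section \<open>Products over primes\<close>

lemma prod_one_minus_inverse_primes_pos:
  assumes "\<And>p. p \<in> P \<Longrightarrow> prime (p::nat)"
  shows "0 < (\<Prod>p\<in>P. 1 - 1 / real p)"
proof (intro prod_pos)
  fix p assume "p \<in> P"
  then have "1 < real p" using assms prime_gt_1_nat by fastforce
  then show "0 < 1 - 1 / real p" by simp
qed

text \<open>The finite form of the Euler product: expanding the product of the geometric series
  \<open>1 / (1 - 1/p)\<close> yields every \<open>1/n\<close> for which \<open>n\<close> has all its prime factors in \<open>P\<close>.\<close>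
lemma prod_primes_mult_smooth_sum_le:
  assumes "finite P" "\<And>p. p \<in> P \<Longrightarrow> prime (p::nat)"
  shows "(\<Prod>p\<in>P. 1 - 1 / real p) *
           (\<Sum>n | n \<in> {1..N} \<and> prime_factors n \<subseteq> P. 1 / real n) \<le> 1"
  using assms
proof (induction P rule: finite_induct)
  case empty
  have "{n. n \<in> {1..N} \<and> prime_factors n \<subseteq> {}} \<subseteq> {1}"
    by (auto simp: prime_factorization_empty_iff)
  then have "(\<Sum>n | n \<in> {1..N} \<and> prime_factors n \<subseteq> {}. 1 / real n) \<le> (\<Sum>n\<in>{1}. 1 / real n)"
    by (intro sum_mono2) auto
  then show ?case by simp
next
  case (insert q P)
  define A where "A = {n. n \<in> {1..N} \<and> prime_factors n \<subseteq> P}"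
  define B where "B = {n. n \<in> {1..N} \<and> prime_factors n \<subseteq> insert q P}"
  have fin: "finite A" "finite B" by (auto simp: A_def B_def)
  have q: "prime q" using insert.prems by auto
  have q1: "real q > 1" using prime_gt_1_nat[OF q] by simp
  \<comment> \<open>A number in \<open>B\<close> that is divisible by \<open>q\<close> is \<open>q\<close> times another one in \<open>B\<close>, so the sum over
    \<open>B\<close> exceeds the sum over \<open>A\<close> by at most \<open>1/q\<close> of itself.\<close>
  have "B \<subseteq> A \<union> (*) q ` B"
  proof
    fix n assume n: "n \<in> B"
    show "n \<in> A \<union> (*) q ` B"
    proof (cases "q dvd n")
      case True
      then obtain m where m: "n = q * m" by (auto elim: dvdE)
      have m0: "m > 0" using n m by (auto simp: B_def intro!: Nat.gr0I)
      have "prime_factors m \<subseteq> prime_factors n"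
        using n m by (intro dvd_prime_factors) (auto simp: B_def)
      moreover have "m \<le> n" using m prime_gt_0_nat[OF q] by simp
      ultimately have "m \<in> B" using n m0 by (auto simp: B_def)
      then show ?thesis using m by auto
    next
      case False
      then have "q \<notin> prime_factors n" by (auto dest: in_prime_factors_imp_dvd)
      then show ?thesis using n by (auto simp: A_def B_def)
    qed
  qed
  then have "(\<Sum>n\<in>B. 1 / real n) \<le> (\<Sum>n\<in>A \<union> (*) q ` B. 1 / real n)"
    using fin by (intro sum_mono2) auto
  also have "\<dots> \<le> (\<Sum>n\<in>A. 1 / real n) + (\<Sum>n\<in>(*) q ` B. 1 / real n)"
    using fin by (subst sum_Un) (auto intro!: sum_nonneg)
  also have "(\<Sum>n\<in>(*) q ` B. 1 / real n) = 1 / real q * (\<Sum>n\<in>B. 1 / real n)"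
    using prime_gt_0_nat[OF q]
    by (subst sum.reindex) (auto simp: inj_on_def sum_distrib_left)
  finally have "(1 - 1 / real q) * (\<Sum>n\<in>B. 1 / real n) \<le> (\<Sum>n\<in>A. 1 / real n)"
    by (simp add: algebra_simps)
  then have "(\<Prod>p\<in>P. 1 - 1 / real p) * ((1 - 1 / real q) * (\<Sum>n\<in>B. 1 / real n))
      \<le> (\<Prod>p\<in>P. 1 - 1 / real p) * (\<Sum>n\<in>A. 1 / real n)"
    using prod_one_minus_inverse_primes_pos[of P] insert.prems by (intro mult_left_mono) auto
  also have "\<dots> \<le> 1" using insert by (simp add: A_def)
  finally show ?case
    unfolding B_def[symmetric] prod.insert[OF insert.hyps] by (simp only: mult_ac)
qed

lemma prod_primes_mult_harm_le:
  "(\<Prod>p | prime p \<and> p \<le> N. 1 - 1 / real p) * harm N \<le> 1"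
proof -
  have "prime_factors n \<subseteq> {p. prime p \<and> p \<le> N}" if "n \<in> {1..N}" for n
  proof
    fix p assume "p \<in> prime_factors n"
    then have "prime p" "p dvd n" by (rule in_prime_factors_imp_prime, rule in_prime_factors_imp_dvd)
    then show "p \<in> {p. prime p \<and> p \<le> N}" using that dvd_imp_le[of p n] by simp
  qed
  then have *: "{n. n \<in> {1..N} \<and> prime_factors n \<subseteq> {p. prime p \<and> p \<le> N}} = {1..N}"
    by blast
  have harm: "(\<Sum>n\<in>{1..N}. 1 / real n) = harm N" by (simp add: harm_def inverse_eq_divide)
  have "(\<Prod>p | prime p \<and> p \<le> N. 1 - 1 / real p) *
      (\<Sum>n | n \<in> {1..N} \<and> prime_factors n \<subseteq> {p. prime p \<and> p \<le> N}. 1 / real n) \<le> 1"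
    by (rule prod_primes_mult_smooth_sum_le) simp_all
  then show ?thesis unfolding * harm .
qed

lemma ex_primes_prod_less:
  fixes K :: nat and \<delta> :: real
  assumes "\<delta> > 0"
  obtains P where "finite P" "\<And>p. p \<in> P \<Longrightarrow> prime p \<and> p > K"
    "(\<Prod>p\<in>P. 1 - 1 / real p) < \<delta>"
proof -
  define Q where "Q = (\<Prod>p | prime p \<and> p \<le> K. 1 - 1 / real p)"
  have Q: "Q > 0" unfolding Q_def by (rule prod_one_minus_inverse_primes_pos) auto
  have "eventually (\<lambda>N. harm N > 1 / (\<delta> * Q)) sequentially"
    using harm_at_top by (simp add: filterlim_at_top_dense)
  then have "eventually (\<lambda>N. harm N > 1 / (\<delta> * Q) \<and> N \<ge> K) sequentially"
    using eventually_ge_at_top by (rule eventually_conj)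
  then obtain N where N: "harm N > 1 / (\<delta> * Q)" "N \<ge> K"
    by (auto simp: eventually_sequentially)
  define P where "P = {p. prime p \<and> K < p \<and> p \<le> N}"
  define R where "R = (\<Prod>p\<in>P. 1 - 1 / real p)"
  have "{p. prime p \<and> p \<le> N} = {p. prime p \<and> p \<le> K} \<union> P"
    using N by (auto simp: P_def)
  then have "(\<Prod>p | prime p \<and> p \<le> N. 1 - 1 / real p) = Q * R"
    unfolding Q_def R_def by (simp only:) (rule prod.union_disjoint, auto simp: P_def)
  then have le: "Q * R * harm N \<le> 1" using prod_primes_mult_harm_le[of N] by simp
  have "R < \<delta>"
  proof (rule ccontr)
    assume "\<not> R < \<delta>"
    then have "\<delta> * (Q * harm N) \<le> R * (Q * harm N)"
      using Q harm_nonneg[of N, where 'a = real] by (intro mult_right_mono) auto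
    moreover have "1 < harm N * (\<delta> * Q)"
      using N(1) Q assms by (subst (asm) pos_divide_less_eq) auto
    ultimately show False using le by (simp add: mult_ac)
  qed
  show ?thesis
  proof (rule that)
    show "finite P" by (simp add: P_def)
    show "prime p \<and> p > K" if "p \<in> P" for p using that by (simp add: P_def)
    show "(\<Prod>p\<in>P. 1 - 1 / real p) < \<delta>" using \<open>R < \<delta>\<close> by (simp only: R_def)
  qed
qed

text \<open>Any preorder on a finite index set, given by a rank function \<open>r\<close>, can be realised by
  attaching to the indices disjoint finite sets of large primes, so that the weights \<open>g i\<close>,
  multiplied by the products over the attached primes, drop by more than a factor 2 whenever
  the rank grows. Indices are treated in order of increasing rank.\<close>
lemma ex_prime_sets_realising_rank:
  fixes g :: "'a \<Rightarrow> real" and r :: "'a \<Rightarrow> int" and K :: nat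
  assumes "finite I" "\<And>i. g i > 0"
  shows "\<exists>A. (\<forall>i\<in>I. finite (A i) \<and> (\<forall>p\<in>A i. prime p \<and> p > K)) \<and>
    (\<forall>i\<in>I. \<forall>j\<in>I. i \<noteq> j \<longrightarrow> A i \<inter> A j = {}) \<and>
    (\<forall>i\<in>I. \<forall>j\<in>I. r i < r j \<longrightarrow>
       2 * (g j * (\<Prod>p\<in>A j. 1 - 1 / real p)) < g i * (\<Prod>p\<in>A i. 1 - 1 / real p))"
  using assms(1)
proof (induction I rule: finite_ranking_induct[where f = r])
  case empty
  show ?case by simp
next
  case (insert x S)
  from insert.IH obtain A where A_IH:
    "\<forall>i\<in>S. finite (A i) \<and> (\<forall>p\<in>A i. prime p \<and> p > K)"
    "\<forall>i\<in>S. \<forall>j\<in>S. i \<noteq> j \<longrightarrow> A i \<inter> A j = {}"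
    "\<forall>i\<in>S. \<forall>j\<in>S. r i < r j \<longrightarrow>
       2 * (g j * (\<Prod>p\<in>A j. 1 - 1 / real p)) < g i * (\<Prod>p\<in>A i. 1 - 1 / real p)"
    by (elim exE conjE) (rule that)
  have A: "finite (A i)" "\<And>p. p \<in> A i \<Longrightarrow> prime p \<and> p > K" if "i \<in> S" for i
    using A_IH(1) that by blast+
  show ?case
  proof (cases "x \<in> S")
    case True
    then show ?thesis using insert.IH by (simp add: insert_absorb)
  next
    case False
    define c where "c = (\<lambda>i. g i * (\<Prod>p\<in>A i. 1 - 1 / real p))"
    define m where "m = Min (insert 1 (c ` S))"
    have c: "c i > 0" if "i \<in> S" for i
      unfolding c_def using assms(2) A(2)[OF that]
      by (intro mult_pos_pos prod_one_minus_inverse_primes_pos) auto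
    have m: "m > 0" "\<And>i. i \<in> S \<Longrightarrow> m \<le> c i"
      using c insert.hyps by (auto simp: m_def)
    have "finite (\<Union>i\<in>S. A i)" using A(1) insert.hyps by auto
    then obtain L where L: "\<And>p. p \<in> (\<Union>i\<in>S. A i) \<Longrightarrow> p \<le> L"
      unfolding finite_nat_set_iff_bounded_le by blast
    have "m / (2 * g x) > 0" using m assms(2) by simp
    then obtain P where P: "finite P" "\<And>p. p \<in> P \<Longrightarrow> prime p \<and> p > max K L"
      "(\<Prod>p\<in>P. 1 - 1 / real p) < m / (2 * g x)"
      by (rule ex_primes_prod_less) blast
    have less: "2 * (g x * (\<Prod>p\<in>P. 1 - 1 / real p)) < c i" if "i \<in> S" for i
      using P(3) m(2)[OF that] assms(2)[of x] by (simp add: field_simps)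
    have disj: "A i \<inter> P = {}" if "i \<in> S" for i
      using L P(2) that by fastforce
    have "\<not> r x < r i" if "i \<in> S" for i
      using insert.hyps that by force
    then have "2 * (g j * (\<Prod>p\<in>(A(x := P)) j. 1 - 1 / real p))
        < g i * (\<Prod>p\<in>(A(x := P)) i. 1 - 1 / real p)"
      if "i \<in> insert x S" "j \<in> insert x S" "r i < r j" for i j
      using that A_IH(3) less[of i] False by (auto simp: c_def)
    moreover have "(A(x := P)) i \<inter> (A(x := P)) j = {}"
      if "i \<in> insert x S" "j \<in> insert x S" "i \<noteq> j" for i j
      using that A_IH(2)[rule_format, of i j] disj[of i] disj[of j]
      by (cases "i = x"; cases "j = x") (simp_all add: Int_commute)
    moreover have "finite ((A(x := P)) i) \<and> (\<forall>p\<in>(A(x := P)) i. prime p \<and> p > K)"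
      if "i \<in> insert x S" for i
      using that A(1,2)[of i] P(1,2) by auto
    ultimately show ?thesis by (intro exI[of _ "A(x := P)"]) blast
  qed
qed

section \<open>Small and large prime factors\<close>

text \<open>The contribution of the primes \<open>p \<le> y\<close> to \<open>\<phi>(m) / m\<close>.\<close>
definition small_part :: "nat \<Rightarrow> nat \<Rightarrow> real" where
  "small_part y m = (\<Prod>p | prime p \<and> p \<le> y \<and> p dvd m. 1 - 1 / real p)"

text \<open>The sum of \<open>1/p\<close> over the prime factors \<open>p > y\<close> of \<open>m\<close>, written with
  \<^const>\<open>prime_factors\<close> so that \<open>m = 0\<close> causes no infinite index set.\<close>
definition large_sum :: "nat \<Rightarrow> nat \<Rightarrow> real" where
  "large_sum y m = (\<Sum>p | p \<in> prime_factors m \<and> p > y. 1 / real p)"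

lemma small_part_pos: "small_part y m > 0"
  unfolding small_part_def by (rule prod_one_minus_inverse_primes_pos) auto

lemma large_sum_nonneg: "large_sum y m \<ge> 0"
  unfolding large_sum_def by (intro sum_nonneg) auto

lemma one_minus_sum_le_prod:
  fixes f :: "'a \<Rightarrow> real"
  assumes "finite A" "\<And>x. x \<in> A \<Longrightarrow> 0 \<le> f x \<and> f x \<le> 1"
  shows "1 - sum f A \<le> (\<Prod>x\<in>A. 1 - f x)"
  using assms
proof (induction A rule: finite_induct)
  case (insert x A)
  have "(\<Prod>x\<in>A. 1 - f x) \<le> 1" using insert.prems by (intro prod_le_1) auto
  then have "f x * (\<Prod>x\<in>A. 1 - f x) \<le> f x * 1"
    using insert.prems by (intro mult_left_mono) auto
  then show ?case using insert by (simp add: algebra_simps)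
qed simp

lemma totient_bounds:
  assumes "m > 0"
  shows "real (totient m) \<le> real m * small_part y m"
    and "real m * small_part y m * (1 - large_sum y m) \<le> real (totient m)"
proof -
  define S where "S = {p. prime p \<and> p \<le> y \<and> p dvd m}"
  define L where "L = {p. p \<in> prime_factors m \<and> p > y}"
  have eq: "prime_factors m = S \<union> L"
    using assms by (auto simp: S_def L_def prime_factors_dvd)
  have fin: "finite S" "finite L" by (auto simp: S_def L_def)
  have "real (totient m) = real m * (\<Prod>p\<in>S \<union> L. 1 - 1 / real p)"
    using totient_formula2[of m] by (simp add: eq)
  also have "\<dots> = real m * (small_part y m * (\<Prod>p\<in>L. 1 - 1 / real p))"
    unfolding small_part_def S_def[symmetric]
    using fin by (subst prod.union_disjoint) (auto simp: S_def L_def)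
  finally have tot: "real (totient m) = real m * small_part y m * (\<Prod>p\<in>L. 1 - 1 / real p)"
    by simp
  have nn: "real m * small_part y m \<ge> 0" using small_part_pos[of y m] by simp
  have "(\<Prod>p\<in>L. 1 - 1 / real p) \<le> 1"
    by (intro prod_le_1) (auto simp: L_def dest: prime_gt_1_nat)
  then show "real (totient m) \<le> real m * small_part y m"
    unfolding tot using mult_left_mono[OF _ nn] by fastforce
  have "1 - large_sum y m \<le> (\<Prod>p\<in>L. 1 - 1 / real p)"
    unfolding large_sum_def L_def[symmetric]
    using fin by (intro one_minus_sum_le_prod) (auto simp: L_def)
  then show "real m * small_part y m * (1 - large_sum y m) \<le> real (totient m)"
    unfolding tot using nn by (rule mult_left_mono)
qed

text \<open>For \<open>n > 2\<close> a factor above 2 between the small parts, less a loss of at most 1/4 by the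
  large primes, decides the comparison of the totients: \<open>2 * 3/4 * n > n + 1\<close>.\<close>
lemma totient_less_of_small_part:
  assumes "2 * small_part y m < small_part y n" "large_sum y n \<le> 1 / 4"
    and "m > 0" "n > 2" "m \<le> n + 1"
  shows "totient m < totient n"
proof -
  have "real (totient m) \<le> real m * small_part y m"
    using assms by (intro totient_bounds)
  also have "\<dots> \<le> (real n + 1) * small_part y m"
    using assms small_part_pos[of y m] by (intro mult_right_mono) auto
  also have "\<dots> \<le> (3 / 2 * real n) * small_part y m"
    using assms small_part_pos[of y m] by (intro mult_right_mono) auto
  also have "\<dots> = (3 / 4 * real n) * (2 * small_part y m)" by simp
  also have "\<dots> < (3 / 4 * real n) * small_part y n"
    using assms by (intro mult_strict_left_mono) auto
  also have "\<dots> = real n * small_part y n * (3 / 4)" by simp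
  also have "\<dots> \<le> real n * small_part y n * (1 - large_sum y n)"
    using assms small_part_pos[of y n] by (intro mult_left_mono) auto
  also have "\<dots> \<le> real (totient n)" using assms by (intro totient_bounds) auto
  finally show ?thesis by simp
qed

lemma small_part_add_fact_mult: "small_part y (m + fact y * t) = small_part y m"
proof -
  have "p dvd m + fact y * t \<longleftrightarrow> p dvd m" if "prime p" "p \<le> y" for p
    using that by (simp add: dvd_add_left_iff prime_dvd_fact_iff dvd_mult2)
  then show ?thesis unfolding small_part_def by (intro prod.cong) auto
qed

section \<open>Choosing the residue class\<close>

text \<open>The Chinese remainder theorem prescribes, for each prime \<open>p \<le> y\<close>, which of the numbers
  \<open>a + 1, \<dots>, a + k\<close> are divisible by \<open>p\<close>.\<close>
lemma ex_residue_class_small_part: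
  fixes k y b :: nat and A :: "nat \<Rightarrow> nat set"
  assumes A: "\<And>i p. i \<in> {1..k} \<Longrightarrow> p \<in> A i \<Longrightarrow> prime p \<and> p > k \<and> p \<le> y"
    and disj: "\<And>i j. i \<in> {1..k} \<Longrightarrow> j \<in> {1..k} \<Longrightarrow> i \<noteq> j \<Longrightarrow> A i \<inter> A j = {}"
    and "k \<le> y"
  obtains a where "a \<ge> b"
    "\<And>i. i \<in> {1..k} \<Longrightarrow> small_part y (a + i) = small_part k i * (\<Prod>p\<in>A i. 1 - 1 / real p)"
proof -
  \<comment> \<open>A prime of \<open>A i\<close> shall divide \<open>a + i\<close>, any other prime shall divide \<open>a\<close>.\<close>
  define u where "u p = (if \<exists>i\<in>{1..k}. p \<in> A i then p - (THE i. i \<in> {1..k} \<and> p \<in> A i) else 0)" for p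
  have u1: "u p = p - i" if "i \<in> {1..k}" "p \<in> A i" for i p
  proof -
    have "(THE i. i \<in> {1..k} \<and> p \<in> A i) = i"
      using that disj by (intro the_equality) blast+
    then show ?thesis using that by (auto simp: u_def)
  qed
  have u2: "u p = 0" if "\<And>i. i \<in> {1..k} \<Longrightarrow> p \<notin> A i" for p
    using that by (auto simp: u_def)
  have "\<exists>x. \<forall>p\<in>{p. prime p \<and> p \<le> y}. [x = u p] (mod p)"
    by (rule chinese_remainder_nat) (auto intro: primes_coprime)
  then obtain x where x: "\<And>p. prime p \<Longrightarrow> p \<le> y \<Longrightarrow> [x = u p] (mod p)" by auto
  \<comment> \<open>The multiple of the modulus \<open>y!\<close> only serves to make \<open>a\<close> at least \<open>b\<close>.\<close>
  define a where "a = x + fact y * b"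
  have a: "p dvd a + i \<longleftrightarrow> p dvd u p + i" if "prime p" "p \<le> y" for p i
  proof -
    have "[fact y * b = 0] (mod p)"
      using that by (simp add: cong_0_iff prime_dvd_fact_iff dvd_mult2)
    then have "[a + i = u p + 0 + i] (mod p)"
      unfolding a_def using x[OF that] by (intro cong_add cong_refl)
    then show ?thesis by (simp add: cong_dvd_iff)
  qed
  have "small_part y (a + i) = small_part k i * (\<Prod>p\<in>A i. 1 - 1 / real p)"
    if i: "i \<in> {1..k}" for i
  proof -
    have *: "p dvd a + i \<longleftrightarrow> p \<le> k \<and> p dvd i \<or> p \<in> A i" if p: "prime p" "p \<le> y" for p
    proof (cases "\<exists>j\<in>{1..k}. p \<in> A j")
      case True
      then obtain j where j: "j \<in> {1..k}" "p \<in> A j" by blast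
      then have pk: "p > k" using A by blast
      have "p dvd u p + i \<longleftrightarrow> i = j"
      proof
        assume "p dvd u p + i"
        then obtain q where q: "p - j + i = p * q" using u1[OF j] by (auto elim: dvdE)
        have "0 < p * q" "p * q < p * 2" using pk i j unfolding q[symmetric] by auto
        then have "q = 1" by (metis One_nat_def less_2_cases mult_less_cancel1 nat_0_less_mult_iff neq0_conv)
        then show "i = j" using q pk j by auto
      next
        assume "i = j"
        then show "p dvd u p + i" using u1[OF j] pk i by simp
      qed
      moreover have "p \<in> A i \<longleftrightarrow> i = j" using disj i j by blast
      ultimately show ?thesis using a[OF p] pk by auto
    next
      case False
      then have "p dvd a + i \<longleftrightarrow> p dvd i" using a[OF p] u2[of p] by auto
      then show ?thesis using False i by (auto dest: dvd_imp_le)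
    qed
    have "{p. prime p \<and> p \<le> y \<and> p dvd a + i} = {p. prime p \<and> p \<le> k \<and> p dvd i} \<union> A i"
      using * A[OF i] \<open>k \<le> y\<close> by auto
    moreover have "finite (A i)"
      using A[OF i] by (intro finite_subset[of "A i" "{..y}"]) auto
    ultimately show ?thesis
      unfolding small_part_def
      by (simp only:) (rule prod.union_disjoint, auto dest!: A[OF i])
  qed
  moreover have "a \<ge> b" unfolding a_def by (simp add: trans_le_add2)
  ultimately show ?thesis using that by blast
qed

section \<open>Large prime factors are rarely relevant\<close>

lemma card_le_of_cong:
  fixes S :: "nat set"
  assumes "S \<subseteq> {..<T}" "p > 0" "\<And>s t. s \<in> S \<Longrightarrow> t \<in> S \<Longrightarrow> [s = t] (mod p)"
  shows "real (card S) \<le> real T / real p + 1"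
proof -
  have "inj_on (\<lambda>t. t div p) S"
  proof (rule inj_onI)
    fix s t assume st: "s \<in> S" "t \<in> S" and div: "s div p = t div p"
    have "s = s div p * p + s mod p" by simp
    also have "s mod p = t mod p"
      using assms(3)[OF st] unfolding unique_euclidean_semiring_class.cong_def .
    also have "s div p * p + t mod p = t" unfolding div by simp
    finally show "s = t" .
  qed
  moreover have "(\<lambda>t. t div p) ` S \<subseteq> {..T div p}"
    using assms(1) by (auto intro!: div_le_mono)
  ultimately have "card S \<le> T div p + 1"
    using card_inj_on_le[of "\<lambda>t. t div p" S "{..T div p}"] by simp
  moreover have "real (T div p) \<le> real T / real p" by (rule of_nat_div_le_of_nat)
  ultimately show ?thesis by linarith
qed

lemma sum_inverse_squares_le:
  assumes "y > 0"
  shows "(\<Sum>n\<in>{y<..N}. 1 / real n ^ 2) \<le> 1 / real y"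
proof (cases "y \<le> N")
  case True
  have "(\<Sum>n\<in>{y<..N}. 1 / real n ^ 2) \<le> 1 / real y - 1 / real N"
    using True
  proof (induction N rule: dec_induct)
    case (step n)
    have "{y<..Suc n} = insert (Suc n) {y<..n}" using step by auto
    moreover have "1 / real (Suc n) ^ 2 \<le> 1 / real n - 1 / real (Suc n)"
    proof -
      have "1 / real (Suc n) ^ 2 \<le> 1 / (real n * real (Suc n))"
        unfolding power2_eq_square using step assms by (intro divide_left_mono mult_right_mono) auto
      also have "\<dots> = 1 / real n - 1 / real (Suc n)"
        using step assms by (simp add: field_simps)
      finally show ?thesis .
    qed
    ultimately show ?case using step by simp
  qed simp
  then show ?thesis by (rule order_trans) simp
qed simp

text \<open>Exchanging the summations, a prime \<open>p > y\<close> is coprime to the modulus \<open>y!\<close> and so divides at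
  most \<open>T/p + 1\<close> of the first \<open>T\<close> members of the progression. The terms \<open>T/p\<close> contribute
  \<open>T \<Sum> 1/p\<^sup>2\<close>, the terms 1 contribute a partial harmonic sum.\<close>
lemma sum_large_sum_le:
  assumes "c > 0" "y > 0"
  shows "(\<Sum>t<T. large_sum y (c + fact y * t)) \<le> real T / real y + harm (c + fact y * T)"
proof -
  define N where "N = c + fact y * T"
  define P where "P = {p. prime p \<and> p \<in> {y<..N}}"
  define D where "D = (\<lambda>p. {t\<in>{..<T}. p dvd c + fact y * t})"
  have finP: "finite P" by (simp add: P_def)
  have "large_sum y (c + fact y * t) = (\<Sum>p\<in>P. if p dvd c + fact y * t then 1 / real p else 0)"
    if "t < T" for t
  proof -
    have le: "c + fact y * t \<le> N" using that by (simp add: N_def)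
    have "{p. p \<in> prime_factors (c + fact y * t) \<and> p > y} = {p \<in> P. p dvd c + fact y * t}"
      using assms le by (auto simp: P_def prime_factors_dvd dest: dvd_imp_le)
    then show ?thesis unfolding large_sum_def using finP by (simp add: sum.inter_filter)
  qed
  then have "(\<Sum>t<T. large_sum y (c + fact y * t))
      = (\<Sum>t<T. \<Sum>p\<in>P. if p dvd c + fact y * t then 1 / real p else 0)"
    by simp
  also have "\<dots> = (\<Sum>p\<in>P. \<Sum>t<T. if p dvd c + fact y * t then 1 / real p else 0)"
    by (rule sum.swap)
  also have "\<dots> = (\<Sum>p\<in>P. real (card (D p)) / real p)"
    by (simp add: D_def flip: sum.inter_filter)
  also have "\<dots> \<le> (\<Sum>p\<in>P. (real T / real p + 1) / real p)"
  proof (intro sum_mono divide_right_mono)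
    fix p assume p: "p \<in> P"
    have "coprime p (fact y)"
      using p by (auto simp: P_def prime_dvd_fact_iff intro!: prime_imp_coprime)
    have "[s = t] (mod p)" if "s \<in> D p" "t \<in> D p" for s t
    proof -
      have "[c + fact y * s = c + fact y * t] (mod p)"
        using that by (auto simp: D_def intro: cong_trans[OF _ cong_sym] simp: cong_0_iff[symmetric])
      then have "[fact y * s = fact y * t] (mod p)" by (simp add: cong_add_lcancel_nat)
      then show ?thesis
        using \<open>coprime p (fact y)\<close> by (simp add: cong_mult_lcancel_nat coprime_commute)
    qed
    then show "real (card (D p)) \<le> real T / real p + 1"
      using p by (intro card_le_of_cong) (auto simp: D_def P_def prime_gt_0_nat)
  qed simp
  also have "\<dots> = real T * (\<Sum>p\<in>P. 1 / real p ^ 2) + (\<Sum>p\<in>P. 1 / real p)"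
    by (simp add: sum.distrib sum_distrib_left add_divide_distrib power2_eq_square)
  also have "\<dots> \<le> real T * (1 / real y) + harm N"
  proof (intro add_mono mult_left_mono)
    have "(\<Sum>p\<in>P. 1 / real p ^ 2) \<le> (\<Sum>n\<in>{y<..N}. 1 / real n ^ 2)"
      by (intro sum_mono2) (auto simp: P_def)
    also have "\<dots> \<le> 1 / real y" using assms by (intro sum_inverse_squares_le)
    finally show "(\<Sum>p\<in>P. 1 / real p ^ 2) \<le> 1 / real y" .
    have "(\<Sum>p\<in>P. 1 / real p) \<le> (\<Sum>n=1..N. 1 / real n)"
      by (intro sum_mono2) (auto simp: P_def)
    then show "(\<Sum>p\<in>P. 1 / real p) \<le> harm N" by (simp add: harm_def field_simps)
  qed simp
  finally show ?thesis by (simp only: N_def times_divide_eq_right mult_1_right)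
qed

text \<open>Markov's inequality for the average just bounded.\<close>
lemma card_large_sum_gt_le:
  assumes "c > 0" "y > 0"
  shows "real (card {t\<in>{..<T}. large_sum y (c + fact y * t) > 1 / 4})
    \<le> 4 * (real T / real y + harm (c + fact y * T))"
proof -
  let ?B = "{t\<in>{..<T}. large_sum y (c + fact y * t) > 1 / 4}"
  have scale: "u \<le> 4 * v" if "u * (1 / 4) \<le> v" for u v :: real
    using that by simp
  have "real (card ?B) * (1 / 4) = (\<Sum>t\<in>?B. 1 / 4)" by simp
  also have "\<dots> \<le> (\<Sum>t\<in>?B. large_sum y (c + fact y * t))"
    by (intro sum_mono) auto
  also have "\<dots> \<le> (\<Sum>t<T. large_sum y (c + fact y * t))"
    by (intro sum_mono2) (auto simp: large_sum_nonneg)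
  also have "\<dots> \<le> real T / real y + harm (c + fact y * T)"
    using assms by (rule sum_large_sum_le)
  finally show ?thesis by (rule scale)
qed

lemma harm_le_ln: "n > 0 \<Longrightarrow> harm n \<le> ln (real n) + 1"
proof -
  assume "n > 0"
  then obtain m where "n = Suc m" by (cases n) auto
  then show ?thesis
    using decseqD[OF decseq_harm_diff_ln, of 0 m] by (simp add: harm_def)
qed

lemma eventually_card_all_large_sum_le:
  fixes k y a :: nat
  assumes "y \<ge> 8 * k" "y > 0"
  shows "eventually (\<lambda>T. real (card {t\<in>{..<T}. \<forall>i\<in>{1..k}. large_sum y (a + i + fact y * t) \<le> 1 / 4})
           \<ge> real T / 4) at_top"
proof -
  define M :: nat where "M = fact y"
  have M: "real M > 0" by (simp add: M_def)
  have "eventually (\<lambda>T. 4 * real k * (ln (real (a + k + 1) + real M * real T) + 1) \<le> real T / 4) at_top"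
    using M by real_asymp
  then show ?thesis
  proof eventually_elim
    case (elim T)
    let ?G = "{t\<in>{..<T}. \<forall>i\<in>{1..k}. large_sum y (a + i + fact y * t) \<le> 1 / 4}"
    let ?B = "\<lambda>i. {t\<in>{..<T}. large_sum y (a + i + fact y * t) > 1 / 4}"
    have B: "real (card (?B i)) \<le> 4 * (real T / real y + (ln (real (a + k + 1) + real M * real T) + 1))"
      if i: "i \<in> {1..k}" for i
    proof -
      have "harm (a + i + M * T) \<le> ln (real (a + i + M * T)) + 1"
        using i by (intro harm_le_ln) auto
      also have "ln (real (a + i + M * T)) \<le> ln (real (a + k + 1) + real M * real T)"
        using i by (subst ln_le_cancel_iff) (auto intro: add_pos_nonneg)
      finally have "harm (a + i + M * T) \<le> ln (real (a + k + 1) + real M * real T) + 1" by simp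
      then show ?thesis
        using card_large_sum_gt_le[of "a + i" y T] i assms unfolding M_def by simp
    qed
    have "{..<T} \<subseteq> ?G \<union> (\<Union>i\<in>{1..k}. ?B i)" by force
    then have "card {..<T} \<le> card (?G \<union> (\<Union>i\<in>{1..k}. ?B i))" by (intro card_mono) auto
    also have "\<dots> \<le> card ?G + card (\<Union>i\<in>{1..k}. ?B i)" by (rule card_Un_le)
    also have "card (\<Union>i\<in>{1..k}. ?B i) \<le> (\<Sum>i=1..k. card (?B i))"
      by (rule card_UN_le) simp
    finally have "T \<le> card ?G + (\<Sum>i=1..k. card (?B i))" by simp
    then have "real T \<le> real (card ?G) + real (\<Sum>i=1..k. card (?B i))"
      unfolding of_nat_add[symmetric] of_nat_le_iff .
    also have "real (\<Sum>i=1..k. card (?B i))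
        \<le> (\<Sum>i=1..k. 4 * (real T / real y + (ln (real (a + k + 1) + real M * real T) + 1)))"
      unfolding of_nat_sum by (intro sum_mono B)
    also have "\<dots> = 4 * real k * (real T / real y)
        + 4 * real k * (ln (real (a + k + 1) + real M * real T) + 1)"
      by (simp add: algebra_simps)
    also have "4 * real k * (real T / real y) \<le> real T / 2"
    proof -
      have "8 * real k * real T \<le> real y * real T"
        using assms by (intro mult_right_mono) linarith+
      then show ?thesis using assms by (simp add: field_simps)
    qed
    finally show ?case using elim by simp
  qed
qed

section \<open>Positive lower density\<close>

lemma lower_density_pos_of_progression:
  fixes S :: "nat set" and a M :: nat
  assumes "M > 0" "c > 0"
    and ev: "eventually (\<lambda>T. real (card {t\<in>{..<T}. a + M * t \<in> S}) \<ge> c * real T) at_top"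
  shows "lower_density S > 0"
proof -
  define T where "T = (\<lambda>x::real. nat \<lfloor>(x - real a) / real M\<rfloor>)"
  have M: "real M > 0" using assms by simp
  have "filterlim T at_top at_top"
    unfolding T_def using M by real_asymp
  then have "eventually (\<lambda>x. real (card {t\<in>{..<T x}. a + M * t \<in> S}) \<ge> c * real (T x)) at_top"
    using ev by (rule eventually_compose_filterlim[rotated])
  moreover have "eventually (\<lambda>x::real. (x - real a) / real M - 1 \<ge> x / (2 * real M)) at_top"
    using M by real_asymp
  moreover have "eventually (\<lambda>x::real. x > real a) at_top" by (rule eventually_gt_at_top)
  ultimately have "eventually (\<lambda>x. ereal (c / (2 * real M))
      \<le> ereal (real (card {n \<in> S. real n \<le> x}) / x)) at_top"
  proof eventually_elim
    case (elim x)
    have Tle: "real (T x) \<le> (x - real a) / real M" "real (T x) \<ge> (x - real a) / real M - 1"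
      using elim M unfolding T_def by (auto simp: divide_nonneg_pos)
    have fin: "finite {n \<in> S. real n \<le> x}"
      by (rule finite_subset[of _ "{..nat \<lfloor>x\<rfloor>}"]) (auto simp: le_nat_floor)
    have sub: "(\<lambda>t. a + M * t) ` {t\<in>{..<T x}. a + M * t \<in> S} \<subseteq> {n \<in> S. real n \<le> x}"
    proof clarsimp
      fix t assume "t < T x"
      then have "real M * real t \<le> real M * real (T x)" using M by (intro mult_left_mono) auto
      also have "\<dots> \<le> x - real a" using Tle(1) M by (simp add: field_simps)
      finally show "real a + real M * real t \<le> x" by simp
    qed
    have "c * (x / (2 * real M)) \<le> c * real (T x)"
      using elim Tle assms by (intro mult_left_mono) auto
    also have "\<dots> \<le> real (card {t\<in>{..<T x}. a + M * t \<in> S})" using elim by simp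
    also have "card {t\<in>{..<T x}. a + M * t \<in> S} = card ((\<lambda>t. a + M * t) ` {t\<in>{..<T x}. a + M * t \<in> S})"
      using assms by (intro card_image[symmetric]) (auto simp: inj_on_def)
    also have "\<dots> \<le> card {n \<in> S. real n \<le> x}" using fin sub by (rule card_mono)
    finally have "c * (x / (2 * real M)) \<le> real (card {n \<in> S. real n \<le> x})" by simp
    moreover have "x > 0" using elim by linarith
    ultimately show ?case using M by (simp add: field_simps)
  qed
  then have "ereal (c / (2 * real M)) \<le> lower_density S"
    unfolding lower_density_def by (rule Liminf_bounded)
  moreover have "0 < ereal (c / (2 * real M))" using assms by simp
  ultimately show ?thesis by (rule less_le_trans[rotated])
qed

theorem corollary2:
  fixes k :: nat and \<epsilon> :: "nat \<Rightarrow> int"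
  assumes "k \<ge> 2"
    and "\<And>i. i \<in> {1..k-1} \<Longrightarrow> \<epsilon> i \<in> {-1, 1}"
  shows "lower_density {n::nat. n > 0 \<and>
           (\<forall>i\<in>{1..k-1}. \<epsilon> i * (int (totient (n + i)) - int (totient (n + i + 1))) > 0)} > 0"
    (is "lower_density ?S > 0")
proof -
  \<comment> \<open>A larger rank will mean a smaller totient, so the ranks follow the walk with steps \<open>\<epsilon> i\<close>.\<close>
  define r :: "nat \<Rightarrow> int" where "r i = (\<Sum>j\<in>{1..<i}. \<epsilon> j)" for i
  have r: "r (i + 1) = r i + \<epsilon> i" if "i \<ge> 1" for i
    using that by (simp add: r_def)
  from ex_prime_sets_realising_rank[of "{1..k}" "small_part k" k r, OF finite_atLeastAtMost small_part_pos]
  obtain A where A_all: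
    "\<forall>i\<in>{1..k}. finite (A i) \<and> (\<forall>p\<in>A i. prime p \<and> p > k)"
    "\<forall>i\<in>{1..k}. \<forall>j\<in>{1..k}. i \<noteq> j \<longrightarrow> A i \<inter> A j = {}"
    "\<forall>i\<in>{1..k}. \<forall>j\<in>{1..k}. r i < r j \<longrightarrow>
       2 * (small_part k j * (\<Prod>p\<in>A j. 1 - 1 / real p))
         < small_part k i * (\<Prod>p\<in>A i. 1 - 1 / real p)"
    by (elim exE conjE) (rule that)
  have A: "finite (A i)" "\<And>p. p \<in> A i \<Longrightarrow> prime p \<and> p > k" if "i \<in> {1..k}" for i
    using A_all(1) that by blast+
  have "finite (\<Union>i\<in>{1..k}. A i)" using A(1) by auto
  then obtain L where L: "\<And>p. p \<in> (\<Union>i\<in>{1..k}. A i) \<Longrightarrow> p \<le> L"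
    unfolding finite_nat_set_iff_bounded_le by blast
  define y where "y = max L (8 * k)"
  have y: "y \<ge> 8 * k" "y > 0" "k \<le> y" using assms(1) by (auto simp: y_def)
  \<comment> \<open>With \<open>a \<ge> 2\<close> every \<open>n + i\<close> below exceeds 2, as the comparison of totients requires.\<close>
  obtain a where a: "a \<ge> 2"
    "\<And>i. i \<in> {1..k} \<Longrightarrow> small_part y (a + i) = small_part k i * (\<Prod>p\<in>A i. 1 - 1 / real p)"
  proof (rule ex_residue_class_small_part[of k A y 2])
    show "prime p \<and> p > k \<and> p \<le> y" if "i \<in> {1..k}" "p \<in> A i" for i p
    proof -
      have "p \<le> L" using L that by blast
      then show ?thesis using A(2)[OF that] by (auto simp: y_def)
    qed
  qed (use A_all(2) y in auto)
  have mem: "a + fact y * t \<in> ?S"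
    if t: "\<forall>i\<in>{1..k}. large_sum y (a + i + fact y * t) \<le> 1 / 4" for t
  proof -
    define n where "n = a + fact y * t"
    have n: "n \<ge> 2" using a by (simp add: n_def)
    have n_add: "a + i + fact y * t = n + i" for i by (simp add: n_def)
    have sp: "small_part y (n + i) = small_part k i * (\<Prod>p\<in>A i. 1 - 1 / real p)"
      if "i \<in> {1..k}" for i
      using small_part_add_fact_mult[of y "a + i" t] a(2)[OF that] by (simp add: n_add)
    have ls: "large_sum y (n + i) \<le> 1 / 4" if "i \<in> {1..k}" for i
      using t that by (simp add: n_add)
    have "\<epsilon> i * (int (totient (n + i)) - int (totient (n + i + 1))) > 0" if i: "i \<in> {1..k-1}" for i
    proof -
      have ik: "i \<in> {1..k}" "i + 1 \<in> {1..k}" using i by auto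
      consider "\<epsilon> i = 1" | "\<epsilon> i = -1" using assms(2)[OF i] by auto
      then show ?thesis
      proof cases
        case 1
        have "totient (n + (i + 1)) < totient (n + i)"
          using A_all(3)[rule_format, OF ik] sp[OF ik(1)] sp[OF ik(2)] ik ls[OF ik(1)] n i 1 r[of i]
          by (intro totient_less_of_small_part[of y]) auto
        then show ?thesis using 1 by simp
      next
        case 2
        have "totient (n + i) < totient (n + (i + 1))"
          using A_all(3)[rule_format, OF ik(2,1)] sp[OF ik(1)] sp[OF ik(2)] ik ls[OF ik(2)] n i 2 r[of i]
          by (intro totient_less_of_small_part[of y]) auto
        then show ?thesis using 2 by simp
      qed
    qed
    then show ?thesis using n by (auto simp: n_def)
  qed
  have sub: "{t\<in>{..<T}. \<forall>i\<in>{1..k}. large_sum y (a + i + fact y * t) \<le> 1 / 4}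
      \<subseteq> {t\<in>{..<T}. a + fact y * t \<in> ?S}" for T
    by (intro Collect_mono impI conjI; elim conjE) (assumption | erule mem)+
  have "eventually (\<lambda>T. real (card {t\<in>{..<T}. a + fact y * t \<in> ?S}) \<ge> 1 / 4 * real T) at_top"
    using eventually_card_all_large_sum_le[OF y(1,2), of a]
  proof eventually_elim
    case (elim T)
    have "card {t\<in>{..<T}. \<forall>i\<in>{1..k}. large_sum y (a + i + fact y * t) \<le> 1 / 4}
        \<le> card {t\<in>{..<T}. a + fact y * t \<in> ?S}"
      using sub by (intro card_mono) auto
    then show ?case using elim by linarith
  qed
  then show ?thesis
    by (rule lower_density_pos_of_progression[rotated 2]) simp_all
qed

end
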